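(* For every positive integer $h$ and every $n\geq 3h^2$, every convex geometric graph on $n$ vertices that is universal for $\mathcal{O}_h(n)$ has $\Omega_h(n^{2-1/h})$ edges; i.e., there is a constant $c_h>0$ depending only on $h$ such that every such graph has at least $c_h\, n^{2-1/h}$ edges.
   Context: A geometric graph is a graph together with a straight-line drawing in the plane in which the vertices are distinct points and the edges are straight-line segments not containing any vertex in their interiors; it is convex if its vertices are in convex position. An embedding of an abstract graph $H$ into a geometric graph $G$ is an injective map $\phi:V(H)\to V(G)$ such that every edge $uv$ of $H$ is mapped to a segment $\phi(u)\phi(v)$ that is an edge of $G$, and any two edges of $H$ are mapped to non-crossing segments. A geometric graph is universal for a class $\mathcal H$ if it contains an embedding of every graph in $\mathcal H$. For $h\ge 0$ and $n\ge 2h+2$, $\mathcal{O}_h(n)$ denotes the family of all outerplanar graphs on $n$ vertices that consist of a spanning (Hamiltonian) cycle plus $h$ pairwise vertex-disjoint chords. *)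

theory Defs
  imports "HOL-Analysis.Analysis"
begin

text \<open>
  A finite simple graph is given by its vertex set and its set of edges, which are two-element
  sets of vertices.
\<close>

definition simple_graph :: "'a set \<Rightarrow> 'a set set \<Rightarrow> bool" where
  "simple_graph V E \<longleftrightarrow> finite V \<and> (\<forall>e\<in>E. e \<subseteq> V \<and> card e = 2)"

definition geometric_graph :: "(real^2) set \<Rightarrow> (real^2) set set \<Rightarrow> bool" where
  "geometric_graph V E \<longleftrightarrow>
     simple_graph V E \<and> (\<forall>a b. {a, b} \<in> E \<longrightarrow> open_segment a b \<inter> V = {})"

definition convex_position :: "(real^2) set \<Rightarrow> bool" where
  "convex_position V \<longleftrightarrow> (\<forall>p\<in>V. p \<notin> convex hull (V - {p}))"

definition convex_geometric_graph :: "(real^2) set \<Rightarrow> (real^2) set set \<Rightarrow> bool" where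
  "convex_geometric_graph V E \<longleftrightarrow> geometric_graph V E \<and> convex_position V"

text \<open>
  No edge of a geometric graph has a vertex in its interior. Hence two distinct edges share a
  point other than a common endpoint iff their relative interiors meet; this is what crossing
  means below.
\<close>

definition embedding ::
  "('a \<Rightarrow> real^2) \<Rightarrow> 'a set \<Rightarrow> 'a set set \<Rightarrow> (real^2) set \<Rightarrow> (real^2) set set \<Rightarrow> bool" where
  "embedding \<phi> W F V E \<longleftrightarrow>
     inj_on \<phi> W \<and> \<phi> ` W \<subseteq> V \<and>
     (\<forall>u v. {u, v} \<in> F \<longrightarrow> {\<phi> u, \<phi> v} \<in> E) \<and>
     (\<forall>u v x y. {u, v} \<in> F \<and> {x, y} \<in> F \<and> {u, v} \<noteq> {x, y} \<longrightarrow>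
        open_segment (\<phi> u) (\<phi> v) \<inter> open_segment (\<phi> x) (\<phi> y) = {})"

definition universal ::
  "(real^2) set \<Rightarrow> (real^2) set set \<Rightarrow> ('a set \<times> 'a set set) set \<Rightarrow> bool" where
  "universal V E \<H> \<longleftrightarrow> (\<forall>(W, F)\<in>\<H>. \<exists>\<phi>. embedding \<phi> W F V E)"

text \<open>
  A plane drawing with vertex positions \<open>p\<close> and an arc \<open>\<gamma> e\<close> (not necessarily straight) for
  each edge \<open>e\<close>.
\<close>

definition plane_drawing ::
  "'a set \<Rightarrow> 'a set set \<Rightarrow> ('a \<Rightarrow> real^2) \<Rightarrow> ('a set \<Rightarrow> real \<Rightarrow> real^2) \<Rightarrow> bool" where
  "plane_drawing V E p \<gamma> \<longleftrightarrow>
     inj_on p V \<and>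
     (\<forall>e\<in>E. arc (\<gamma> e) \<and> {pathstart (\<gamma> e), pathfinish (\<gamma> e)} = p ` e \<and>
             path_image (\<gamma> e) \<inter> p ` V = p ` e) \<and>
     (\<forall>e\<in>E. \<forall>f\<in>E. e \<noteq> f \<longrightarrow> path_image (\<gamma> e) \<inter> path_image (\<gamma> f) = p ` (e \<inter> f))"

text \<open>
  Outerplanarity: some plane drawing has all vertices on the boundary of the outer face. The
  outer face is the unbounded component of the complement of the drawing, which is
  \<^term>\<open>outside\<close> of the drawing: the drawing is compact, so in the plane its complement has just
  one unbounded component.
\<close>

definition outerplanar :: "'a set \<Rightarrow> 'a set set \<Rightarrow> bool" where
  "outerplanar V E \<longleftrightarrow>
     simple_graph V E \<and>
     (\<exists>p \<gamma>. plane_drawing V E p \<gamma> \<and>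
        p ` V \<subseteq> frontier (outside (p ` V \<union> (\<Union>e\<in>E. path_image (\<gamma> e)))))"

definition cycle_edges :: "'a list \<Rightarrow> 'a set set" where
  "cycle_edges vs = {{vs ! i, vs ! (Suc i mod length vs)} | i. i < length vs}"

definition hamiltonian_cycle :: "'a set \<Rightarrow> 'a set set \<Rightarrow> bool" where
  "hamiltonian_cycle V C \<longleftrightarrow>
     (\<exists>vs. distinct vs \<and> set vs = V \<and> 3 \<le> length vs \<and> C = cycle_edges vs)"

text \<open>
  The family \<open>\<O>\<^sub>h(n)\<close> of outerplanar graphs on \<open>n\<close> vertices that consist of a Hamiltonian cycle
  \<open>C\<close> plus a set \<open>M\<close> of \<open>h\<close> pairwise vertex-disjoint chords. It is intended for \<open>n \<ge> 2h + 2\<close>.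
\<close>

definition outerplanar_family :: "nat \<Rightarrow> nat \<Rightarrow> ('a set \<times> 'a set set) set" where
  "outerplanar_family h n =
     {(V, E). outerplanar V E \<and> card V = n \<and>
        (\<exists>C M. hamiltonian_cycle V C \<and> E = C \<union> M \<and> C \<inter> M = {} \<and>
               card M = h \<and> pairwise disjnt M)}"

end

theory Submission
  imports Defs
begin

text \<open>
  The proof is by counting. In a convex geometric graph, a Hamiltonian cycle without crossings has
  to follow the boundary of the convex hull, since the rest of the cycle would cross any edge with
  vertices on both sides. So there are at most \<open>2n\<close> ways to place the cycle \<open>0, 1, \<dots>, n - 1\<close>, and
  once it is placed, the chords are determined by their images, an \<open>h\<close>-element set of edges.
  With \<open>s = n div (3h)\<close> there are \<open>s ^ (2h)\<close> sets of chords that have exactly one chord in each of \<open>h\<close>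
  blocks of \<open>3s\<close> consecutive vertices. Hence \<open>s ^ (2h) \<le> 2 n |E| ^ h\<close>.
\<close>

section \<open>Outerplanar graphs drawn on a parabola\<close>

text \<open>Vertex \<open>k\<close> will be drawn at \<open>parabola k\<close>. The curve is
  strictly convex, so chords meet away from shared endpoints exactly when their abscissae
  interleave, and it bounds a convex region.\<close>

definition parabola :: "real \<Rightarrow> real^2" where
  "parabola x = vector [x, x\<^sup>2]"

lemma parabola_nth [simp]: "parabola x $ 1 = x" "parabola x $ 2 = x\<^sup>2"
  by (simp_all add: parabola_def)

lemma parabola_eq_iff [simp]: "parabola x = parabola y \<longleftrightarrow> x = y"
  by (metis parabola_nth(1))

lemma vec2_eqI:
  fixes x y :: "real^2"
  assumes "x $ 1 = y $ 1" "x $ 2 = y $ 2"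
  shows "x = y"
  using assms by (simp add: vec_eq_iff forall_2)

text \<open>At abscissa \<open>x\<close> the chord lies \<open>(x - a) * (b - x)\<close> above the
  parabola; comparing these excesses reduces intersections of chords to algebra.\<close>

lemma closed_segment_parabolaD:
  assumes "z \<in> closed_segment (parabola a) (parabola b)" "a \<le> b"
  shows "a \<le> z $ 1" "z $ 1 \<le> b" "z $ 2 = (z $ 1)\<^sup>2 + (z $ 1 - a) * (b - z $ 1)"
proof -
  obtain u where u: "0 \<le> u" "u \<le> 1" and z: "z = (1 - u) *\<^sub>R parabola a + u *\<^sub>R parabola b"
    using assms(1) by (auto simp: in_segment)
  have z1: "z $ 1 = a + u * (b - a)" and z2: "z $ 2 = (1 - u) * a\<^sup>2 + u * b\<^sup>2"
    by (simp_all add: z algebra_simps)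
  show "a \<le> z $ 1" using u assms(2) z1 by simp
  have "u * (b - a) \<le> 1 * (b - a)" using u assms(2) by (intro mult_right_mono) auto
  then show "z $ 1 \<le> b" using z1 by simp
  show "z $ 2 = (z $ 1)\<^sup>2 + (z $ 1 - a) * (b - z $ 1)"
    unfolding z1 z2 by (simp add: algebra_simps power2_eq_square)
qed

lemma parabola_mem_chord_iff:
  assumes "a < b"
  shows "parabola x \<in> closed_segment (parabola a) (parabola b) \<longleftrightarrow> x = a \<or> x = b"
  using closed_segment_parabolaD(3)[of "parabola x" a b] assms by auto

lemma nested_chords_meet:
  assumes z: "z \<in> closed_segment (parabola a) (parabola b)"
    "z \<in> closed_segment (parabola c) (parabola d)"
    and ord: "a \<le> c" "c < d" "d \<le> b" and ne: "(a, b) \<noteq> (c, d)"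
  shows "(z = parabola c \<and> a = c) \<or> (z = parabola d \<and> b = d)"
proof -
  define x where "x = z $ 1"
  have ab: "a \<le> b" and cd: "c \<le> d" using ord by auto
  note za = closed_segment_parabolaD[OF z(1) ab, folded x_def]
    and zc = closed_segment_parabolaD[OF z(2) cd, folded x_def]
  have eq: "(x - a) * (b - x) = (x - c) * (d - x)" using za(3) zc(3) by simp
  consider "x = c" | "x = d" | "c < x" "x < d" using zc by fastforce
  then show ?thesis
  proof cases
    case 1
    then have "z = parabola c" using zc by (intro vec2_eqI) (simp_all add: x_def)
    moreover have "a = c" using eq 1 ord by auto
    ultimately show ?thesis by blast
  next
    case 2
    then have "z = parabola d" using zc by (intro vec2_eqI) (simp_all add: x_def)
    moreover have "b = d" using eq 2 ord by auto
    ultimately show ?thesis by blast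
  next
    case 3
    \<comment> \<open>For \<open>c < x < d\<close> both summands on the right are nonnegative. Equal
      heights make both vanish, which forces \<open>a = c\<close> and \<open>b = d\<close>.\<close>
    have "(x - a) * (b - x) - (x - c) * (d - x) = (c - a) * (b - x) + (x - c) * (b - d)"
      by (simp add: algebra_simps)
    moreover have "0 \<le> (c - a) * (b - x)" "0 \<le> (x - c) * (b - d)"
      using 3 ord by auto
    ultimately have "(c - a) * (b - x) = 0" "(x - c) * (b - d) = 0"
      using eq by linarith+
    then show ?thesis using 3 ord ne by auto
  qed
qed

lemma successive_chords_meet:
  assumes z: "z \<in> closed_segment (parabola a) (parabola b)"
    "z \<in> closed_segment (parabola c) (parabola d)"
    and ord: "a < b" "b \<le> c" "c < d"
  shows "z = parabola b \<and> b = c"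
proof -
  have ab: "a \<le> b" and cd: "c \<le> d" using ord by auto
  note za = closed_segment_parabolaD[OF z(1) ab]
    and zc = closed_segment_parabolaD[OF z(2) cd]
  have "z $ 1 = b" "b = c" using za(2) zc(1) ord by auto
  then show ?thesis using za(3) by (auto intro: vec2_eqI)
qed

text \<open>Intervals that do not interleave are successive or nested, so the two preceding lemmas
  apply, if necessary with the chords exchanged.\<close>

lemma noncrossing_chords_meet:
  fixes a b c d :: nat
  assumes ab: "a < b" and cd: "c < d" and ne: "{a, b} \<noteq> {c, d}"
    and nc: "\<not> (a < c \<and> c < b \<and> b < d)" "\<not> (c < a \<and> a < d \<and> d < b)"
    and z: "z \<in> closed_segment (parabola a) (parabola b)"
      "z \<in> closed_segment (parabola c) (parabola d)"
  shows "\<exists>k. z = parabola (real k) \<and> k \<in> {a, b} \<inter> {c, d}"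
proof -
  consider "b \<le> c" | "d \<le> a" | "a \<le> c" "d \<le> b" | "c \<le> a" "b \<le> d"
    using ab cd nc by linarith
  then show ?thesis
  proof cases
    case 1
    then show ?thesis using successive_chords_meet[OF z] ab cd by auto
  next
    case 2
    then show ?thesis using successive_chords_meet[OF z(2) z(1)] ab cd by auto
  next
    case 3
    then show ?thesis using nested_chords_meet[OF z] ab cd ne by force
  next
    case 4
    then show ?thesis using nested_chords_meet[OF z(2) z(1)] ab cd ne by force
  qed
qed

section \<open>The region above the parabola and the outer face\<close>

lemma convex_epigraph_square: "convex {z :: real^2. (z $ 1)\<^sup>2 \<le> z $ 2}"
proof (rule convexI)
  fix x y :: "real^2" and u v :: real
  assume x: "x \<in> {z. (z $ 1)\<^sup>2 \<le> z $ 2}" and y: "y \<in> {z. (z $ 1)\<^sup>2 \<le> z $ 2}"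
    and uv: "0 \<le> u" "0 \<le> v" "u + v = 1"
  have v: "v = 1 - u" using uv by simp
  have "u * (x $ 1)\<^sup>2 + v * (y $ 1)\<^sup>2 - (u * x $ 1 + v * y $ 1)\<^sup>2 = u * v * (x $ 1 - y $ 1)\<^sup>2"
    unfolding v by (simp add: algebra_simps power2_eq_square)
  moreover have "0 \<le> u * v * (x $ 1 - y $ 1)\<^sup>2" using uv by simp
  moreover have "u * (x $ 1)\<^sup>2 \<le> u * x $ 2" "v * (y $ 1)\<^sup>2 \<le> v * y $ 2"
    using x y uv by (auto intro: mult_left_mono)
  ultimately show "u *\<^sub>R x + v *\<^sub>R y \<in> {z. (z $ 1)\<^sup>2 \<le> z $ 2}" by simp
qed

text \<open>Everything below the parabola lies in \<open>outside D\<close>, because the region on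
  and above it is convex and contains \<open>D\<close>. Points straight below
  \<open>parabola x\<close> approach it from there.\<close>

lemma parabola_in_frontier_outside:
  assumes D: "D \<subseteq> {z. (z $ 1)\<^sup>2 \<le> z $ 2}" and p: "parabola x \<in> D"
  shows "parabola x \<in> frontier (outside D)"
proof -
  have out: "- {z :: real^2. (z $ 1)\<^sup>2 \<le> z $ 2} \<subseteq> outside D"
    using outside_mono[OF D] outside_convex[OF convex_epigraph_square] by simp
  have "parabola x \<in> closure (outside D)"
  proof (subst closure_approachable, intro allI impI)
    fix e :: real assume e: "e > 0"
    define y where "y = parabola x - axis 2 (e / 2)"
    have "y $ 1 = x" "y $ 2 = x\<^sup>2 - e / 2" by (simp_all add: y_def axis_def)
    then have "y \<in> outside D" using out e by auto
    moreover have "dist y (parabola x) < e" using e by (simp add: y_def dist_norm norm_eq_sqrt_inner inner_axis_axis real_sqrt_divide)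
    ultimately show "\<exists>y\<in>outside D. dist y (parabola x) < e" by blast
  qed
  moreover have "parabola x \<notin> interior (outside D)"
    using p interior_subset outside_no_overlap by blast
  ultimately show ?thesis by (simp add: frontier_def)
qed

text \<open>Straight chords of the parabola serve as arcs. Condition \<open>nc\<close> forbids one
  order of interleaving; exchanging the two edges gives the other.\<close>

lemma outerplanar_noncrossing:
  fixes V :: "nat set"
  assumes sg: "simple_graph V E"
    and nc: "\<And>a b c d. {a, b} \<in> E \<Longrightarrow> {c, d} \<in> E \<Longrightarrow> a < c \<Longrightarrow> c < b \<Longrightarrow> b < d \<Longrightarrow> False"
  shows "outerplanar V E"
proof -
  define p where "p k = parabola (real k)" for k
  \<comment> \<open>\<open>Min\<close> and \<open>Max\<close> order the endpoints of the unordered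
    edge, since the chord lemmas expect the left endpoint first.\<close>
  define \<gamma> where "\<gamma> e = linepath (p (Min e)) (p (Max e))" for e
  have edge: "\<exists>a b. e = {a, b} \<and> a < b \<and> a \<in> V \<and> b \<in> V \<and> \<gamma> e = linepath (p a) (p b)"
    if "e \<in> E" for e
  proof -
    have "card e = 2" "e \<subseteq> V" using sg that by (auto simp: simple_graph_def)
    then obtain x y where "e = {x, y}" "x \<noteq> y" by (meson card_2_iff)
    then obtain a b where "e = {a, b}" "a < b"
      by (metis insert_commute linorder_neqE_nat)
    then show ?thesis using \<open>e \<subseteq> V\<close> by (auto simp: \<gamma>_def)
  qed
  have inj: "inj_on p V" by (simp add: inj_on_def p_def)
  have "plane_drawing V E p \<gamma>"
    unfolding plane_drawing_def
  proof (intro conjI ballI impI)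
    show "inj_on p V" by fact
  next
    fix e assume "e \<in> E"
    then obtain a b where e: "e = {a, b}" "a < b" "a \<in> V" "b \<in> V" "\<gamma> e = linepath (p a) (p b)"
      using edge by blast
    then show "arc (\<gamma> e)" "{pathstart (\<gamma> e), pathfinish (\<gamma> e)} = p ` e"
      by (auto simp: p_def intro!: arc_linepath)
    show "path_image (\<gamma> e) \<inter> p ` V = p ` e"
      using e by (auto simp: p_def parabola_mem_chord_iff)
  next
    fix e f assume ef: "e \<in> E" "f \<in> E" "e \<noteq> f"
    obtain a b where e: "e = {a, b}" "a < b" "a \<in> V" "b \<in> V" "\<gamma> e = linepath (p a) (p b)"
      using edge ef by blast
    obtain c d where f: "f = {c, d}" "c < d" "c \<in> V" "d \<in> V" "\<gamma> f = linepath (p c) (p d)"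
      using edge ef by blast
    have "path_image (\<gamma> e) \<inter> path_image (\<gamma> f) \<subseteq> p ` (e \<inter> f)"
    proof
      fix z assume "z \<in> path_image (\<gamma> e) \<inter> path_image (\<gamma> f)"
      then have z: "z \<in> closed_segment (parabola a) (parabola b)"
        "z \<in> closed_segment (parabola c) (parabola d)"
        using e f by (auto simp: p_def)
      have "\<not> (a < c \<and> c < b \<and> b < d)" "\<not> (c < a \<and> a < d \<and> d < b)"
        using nc ef e(1) f(1) by blast+
      then show "z \<in> p ` (e \<inter> f)"
        using noncrossing_chords_meet[OF e(2) f(2) _ _ _ z] ef(3) e(1) f(1) by (auto simp: p_def)
    qed
    then show "path_image (\<gamma> e) \<inter> path_image (\<gamma> f) = p ` (e \<inter> f)"
      using e f by auto
  qed
  moreover have "p ` V \<subseteq> frontier (outside (p ` V \<union> (\<Union>e\<in>E. path_image (\<gamma> e))))"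
  proof -
    have "path_image (\<gamma> e) \<subseteq> {z. (z $ 1)\<^sup>2 \<le> z $ 2}" if e: "e \<in> E" for e
    proof -
      obtain a b where "\<gamma> e = linepath (p a) (p b)" using edge[OF e] by blast
      moreover have "closed_segment (p a) (p b) \<subseteq> {z. (z $ 1)\<^sup>2 \<le> z $ 2}"
        by (rule closed_segment_subset[OF _ _ convex_epigraph_square]) (simp_all add: p_def)
      ultimately show ?thesis by simp
    qed
    then have "p ` V \<union> (\<Union>e\<in>E. path_image (\<gamma> e)) \<subseteq> {z. (z $ 1)\<^sup>2 \<le> z $ 2}"
      by (auto simp: p_def)
    then show ?thesis by (auto simp: p_def intro: parabola_in_frontier_outside)
  qed
  ultimately show ?thesis using sg unfolding outerplanar_def by blast
qed

section \<open>Crossing-free Hamiltonian cycles in convex position\<close>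

text \<open>Twice the signed area of the triangle \<open>p q r\<close>: positive iff
  \<open>r\<close> lies to the left of the directed line from \<open>p\<close> to \<open>q\<close>,
  zero iff the points are collinear.\<close>

definition orient :: "real^2 \<Rightarrow> real^2 \<Rightarrow> real^2 \<Rightarrow> real" where
  "orient p q r = (q $ 1 - p $ 1) * (r $ 2 - p $ 2) - (q $ 2 - p $ 2) * (r $ 1 - p $ 1)"

lemma orient_swap: "orient q p r = - orient p q r" and orient_rotate: "orient q r p = orient p q r"
  by (simp_all add: orient_def algebra_simps)

lemma orient_eq_0_imp:
  assumes "orient p q z = 0" "p \<noteq> q"
  obtains u where "z = (1 - u) *\<^sub>R p + u *\<^sub>R q"
proof -
  have o: "(q $ 1 - p $ 1) * (z $ 2 - p $ 2) = (q $ 2 - p $ 2) * (z $ 1 - p $ 1)"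
    using assms(1) by (simp add: orient_def)
  consider "q $ 1 \<noteq> p $ 1" | "q $ 2 \<noteq> p $ 2" using assms(2) vec2_eqI by metis
  then show ?thesis
  proof cases
    case 1
    define u where "u = (z $ 1 - p $ 1) / (q $ 1 - p $ 1)"
    have "z $ 1 = p $ 1 + u * (q $ 1 - p $ 1)" "z $ 2 = p $ 2 + u * (q $ 2 - p $ 2)"
      using 1 o by (simp_all add: u_def field_simps)
    then show ?thesis by (intro that[of u] vec2_eqI) (simp_all add: algebra_simps)
  next
    case 2
    define u where "u = (z $ 2 - p $ 2) / (q $ 2 - p $ 2)"
    have "z $ 2 = p $ 2 + u * (q $ 2 - p $ 2)" "z $ 1 = p $ 1 + u * (q $ 1 - p $ 1)"
      using 2 o by (simp_all add: u_def field_simps)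
    then show ?thesis by (intro that[of u] vec2_eqI) (simp_all add: algebra_simps)
  qed
qed

text \<open>One of three collinear points lies between the other two; the range of \<open>u\<close>
  tells which one.\<close>

lemma line_point_cases:
  fixes p q z :: "'a::real_vector"
  assumes z: "z = (1 - u) *\<^sub>R p + u *\<^sub>R q" and "p \<noteq> q"
  shows "p \<in> closed_segment z q \<or> q \<in> closed_segment z p \<or> z \<in> open_segment p q"
proof -
  consider "u \<le> 0" | "u \<ge> 1" | "0 < u" "u < 1" by linarith
  then show ?thesis
  proof cases
    case 1
    \<comment> \<open>The coefficient of \<open>q\<close> when the equation for \<open>z\<close> is
      solved for \<open>p\<close>.\<close>
    define t where "t = - u / (1 - u)"
    have "0 \<le> t" "t \<le> 1" "1 - t = 1 / (1 - u)" using 1 by (auto simp: t_def field_simps)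
    moreover have "p = (1 / (1 - u)) *\<^sub>R z + t *\<^sub>R q"
      using 1 by (simp add: z t_def scaleR_add_right)
    ultimately show ?thesis by (metis in_segment(1))
  next
    case 2
    define t where "t = (u - 1) / u"
    have "0 \<le> t" "t \<le> 1" "1 - t = 1 / u" using 2 by (auto simp: t_def field_simps)
    moreover have "q = (1 / u) *\<^sub>R z + t *\<^sub>R p"
    proof -
      have "(1 / u) *\<^sub>R z + t *\<^sub>R p = ((1 - u) / u + (u - 1) / u) *\<^sub>R p + q"
        using 2 by (simp add: z t_def scaleR_add_right scaleR_add_left)
      also have "(1 - u) / u + (u - 1) / u = 0" by (simp flip: add_divide_distrib)
      finally show ?thesis by simp
    qed
    ultimately show ?thesis by (metis in_segment(1))
  next
    case 3
    then show ?thesis using assms by (auto simp: in_segment)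
  qed
qed

lemma convex_positionD:
  assumes "convex_position V" "p \<in> V" "S \<subseteq> V" "p \<notin> S"
  shows "p \<notin> convex hull S"
proof -
  have "S \<subseteq> V - {p}" using assms by auto
  then show ?thesis using assms hull_mono[of S "V - {p}" convex] by (auto simp: convex_position_def)
qed

text \<open>A collinear triple would put one of its points into the hull of the other two.\<close>

lemma convex_position_orient_ne_0:
  assumes cp: "convex_position V" and V: "p \<in> V" "q \<in> V" "r \<in> V"
    and ne: "p \<noteq> q" "r \<noteq> p" "r \<noteq> q"
  shows "orient p q r \<noteq> 0"
proof
  assume "orient p q r = 0"
  then obtain u where "r = (1 - u) *\<^sub>R p + u *\<^sub>R q" using ne orient_eq_0_imp by metis
  from line_point_cases[OF this ne(1)]
  have "p \<in> convex hull {r, q} \<or> q \<in> convex hull {r, p} \<or> r \<in> convex hull {p, q}"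
    by (auto simp: segment_convex_hull open_segment_def)
  moreover have "p \<notin> convex hull {r, q}" "q \<notin> convex hull {r, p}" "r \<notin> convex hull {p, q}"
    by (rule convex_positionD[OF cp]; use V ne in auto)+
  ultimately show False by blast
qed

text \<open>The segment from \<open>x\<close> to \<open>y\<close> meets the line through
  \<open>p\<close> and \<open>q\<close> in a point \<open>z\<close>. Were \<open>z\<close> not
  strictly between \<open>p\<close> and \<open>q\<close>, one of these would lie on the segment from
  \<open>z\<close> to the other, hence in the hull of three other vertices.\<close>

lemma convex_position_crossing:
  assumes cp: "convex_position V" and V: "p \<in> V" "q \<in> V" "x \<in> V" "y \<in> V" and pq: "p \<noteq> q"
    and o: "orient p q x > 0" "orient p q y < 0"
  shows "open_segment p q \<inter> open_segment x y \<noteq> {}"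
proof -
  \<comment> \<open>\<open>orient p q\<close> is affine along the segment from \<open>x\<close> to
    \<open>y\<close>, and \<open>t\<close> is the parameter of its zero.\<close>
  define t where "t = orient p q x / (orient p q x - orient p q y)"
  define z where "z = (1 - t) *\<^sub>R x + t *\<^sub>R y"
  have t: "0 < t" "t < 1" using o by (auto simp: t_def field_simps)
  have xy: "x \<noteq> y" using o by auto
  have z_open: "z \<in> open_segment x y" using t xy by (auto simp: in_segment z_def)
  have "orient p q z = (1 - t) * orient p q x + t * orient p q y"
    by (simp add: orient_def z_def algebra_simps)
  also have "\<dots> = orient p q x - t * (orient p q x - orient p q y)" by (simp add: algebra_simps)
  also have "\<dots> = 0" using o by (simp add: t_def)
  finally obtain u where u: "z = (1 - u) *\<^sub>R p + u *\<^sub>R q" using pq orient_eq_0_imp by metis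
  have no: "x \<noteq> p" "x \<noteq> q" "y \<noteq> p" "y \<noteq> q" using o by (auto simp: orient_def)
  have hull: "closed_segment z w \<subseteq> convex hull {x, y, w}" for w
  proof (rule closed_segment_subset)
    have "z \<in> convex hull {x, y}" using z_open by (auto simp: segment_convex_hull open_segment_def)
    then show "z \<in> convex hull {x, y, w}" using hull_mono[of "{x, y}" "{x, y, w}" convex] by auto
  qed (auto intro: hull_inc)
  have "p \<notin> convex hull {x, y, q}" "q \<notin> convex hull {x, y, p}"
    by (rule convex_positionD[OF cp]; use V no pq in auto)+
  then have "z \<in> open_segment p q"
    using line_point_cases[OF u pq] hull by blast
  then show ?thesis using z_open by blast
qed

text \<open>For \<open>p \<noteq> q\<close> this is an edge of the hull boundary traversed
  counterclockwise.\<close>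

definition hull_edge :: "(real^2) set \<Rightarrow> real^2 \<Rightarrow> real^2 \<Rightarrow> bool" where
  "hull_edge V p q \<longleftrightarrow> p \<in> V \<and> q \<in> V \<and> (\<forall>r\<in>V - {p, q}. orient p q r > 0)"

text \<open>\<open>orient p q q'\<close> and \<open>orient p q' q\<close> are opposite numbers, so
  they cannot both be positive.\<close>

lemma hull_edge_target_unique:
  assumes "hull_edge V p q" "hull_edge V p q'" "q \<noteq> p" "q' \<noteq> p"
  shows "q = q'"
proof (rule ccontr)
  assume "q \<noteq> q'"
  then have "orient p q q' > 0" "orient p q' q > 0" using assms by (auto simp: hull_edge_def)
  then show False using orient_swap orient_rotate by (metis neg_0_less_iff_less not_less_iff_gr_or_eq)
qed

lemma hull_edge_source_unique:
  assumes "hull_edge V q p" "hull_edge V q' p" "q \<noteq> p" "q' \<noteq> p"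
  shows "q = q'"
proof (rule ccontr)
  assume "q \<noteq> q'"
  then have "orient q p q' > 0" "orient q' p q > 0" using assms by (auto simp: hull_edge_def)
  then show False using orient_swap orient_rotate by (metis neg_0_less_iff_less not_less_iff_gr_or_eq)
qed

section \<open>Periodic crossing-free sequences run around the hull in one direction\<close>

text \<open>A cyclic sequence is a function on all naturals of exact period \<open>n\<close>, which keeps
  indices modulo \<open>n\<close> out of the arguments.\<close>

locale noncrossing_cycle =
  fixes n :: nat and \<psi> :: "nat \<Rightarrow> real^2" and V :: "(real^2) set"
  assumes n_ge_3: "n \<ge> 3"
    and eq_iff: "\<psi> j = \<psi> k \<longleftrightarrow> j mod n = k mod n"
    and range: "range \<psi> = V"
    and noncrossing: "{\<psi> j, \<psi> (Suc j)} \<noteq> {\<psi> k, \<psi> (Suc k)} \<Longrightarrow>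
      open_segment (\<psi> j) (\<psi> (Suc j)) \<inter> open_segment (\<psi> k) (\<psi> (Suc k)) = {}"
    and convex: "convex_position V"
begin

lemma in_V [simp]: "\<psi> j \<in> V"
  using range by auto

lemma shift_ne:
  assumes "0 < d" "d < n"
  shows "\<psi> (j + d) \<noteq> \<psi> j"
proof
  assume "\<psi> (j + d) = \<psi> j"
  then have "(j + d) mod n = j mod n" by (simp add: eq_iff)
  then have "n dvd d" using mod_eq_dvd_iff_nat[of j "j + d" n] by simp
  then show False using assms by (auto dest: dvd_imp_le)
qed

lemma Suc_ne: "\<psi> (Suc j) \<noteq> \<psi> j" "\<psi> (Suc (Suc j)) \<noteq> \<psi> j"
  using shift_ne[of 1 j] shift_ne[of 2 j] n_ge_3 by simp_all

text \<open>The vertices from \<open>\<psi> (j + 2)\<close> to \<open>\<psi> (j + n - 1)\<close>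
  form a path that avoids both ends of the edge. A change of side along it would make an edge of the
  path cross that edge.\<close>

lemma same_side:
  assumes "2 \<le> d" "d < n"
  shows "(orient (\<psi> j) (\<psi> (Suc j)) (\<psi> (j + d)) > 0) \<longleftrightarrow>
    (orient (\<psi> j) (\<psi> (Suc j)) (\<psi> (j + 2)) > 0)"
  using assms
proof (induction d rule: dec_induct)
  case (step d)
  let ?p = "\<psi> j" and ?q = "\<psi> (Suc j)" and ?x = "\<psi> (j + d)" and ?y = "\<psi> (Suc (j + d))"
  have ne: "?x \<noteq> ?p" "?x \<noteq> ?q" "?y \<noteq> ?p" "?y \<noteq> ?q"
    using shift_ne[of d j] shift_ne[of "d - 1" "Suc j"] shift_ne[of "Suc d" j]
      shift_ne[of d "Suc j"] step by simp_all
  have pq: "?p \<noteq> ?q" using Suc_ne(1)[of j] by simp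
  have nz: "orient ?p ?q ?x \<noteq> 0" "orient ?p ?q ?y \<noteq> 0"
    using convex_position_orient_ne_0[OF convex in_V in_V in_V pq] ne by blast+
  have "{?p, ?q} \<noteq> {?x, ?y}" using ne by auto
  then have disj: "open_segment ?p ?q \<inter> open_segment ?x ?y = {}" by (rule noncrossing)
  have "\<not> (orient ?p ?q ?x > 0 \<and> orient ?p ?q ?y < 0)"
    using convex_position_crossing[OF convex in_V in_V in_V in_V pq] disj by blast
  moreover have "\<not> (orient ?p ?q ?y > 0 \<and> orient ?p ?q ?x < 0)"
    using convex_position_crossing[OF convex in_V in_V in_V in_V pq] disj
    by (metis open_segment_commute)
  ultimately show ?case using nz step by auto
qed simp

lemma in_V_cases:
  assumes "r \<in> V" "r \<noteq> \<psi> j" "r \<noteq> \<psi> (Suc j)"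
  obtains d where "2 \<le> d" "d < n" "r = \<psi> (j + d)"
proof -
  obtain k where k: "r = \<psi> k" using assms range by auto
  \<comment> \<open>This is \<open>k - j\<close> modulo \<open>n\<close>; adding
    \<open>n - j mod n\<close> avoids truncated subtraction.\<close>
  define d where "d = (k + (n - j mod n)) mod n"
  have n0: "n > 0" using n_ge_3 by simp
  have "(j + d) mod n = (j mod n + (k + (n - j mod n))) mod n"
    unfolding d_def by (simp add: mod_simps)
  also have "j mod n + (k + (n - j mod n)) = k + n"
    using mod_less_divisor[OF n0, of j] by simp
  finally have r: "r = \<psi> (j + d)" by (simp add: k eq_iff)
  have "d \<noteq> 0" "d \<noteq> 1" using r assms by (auto intro: gr0I)
  then show ?thesis using that[of d] r n0 by (simp add: d_def)
qed

text \<open>\<open>same_side\<close> puts all other vertices on one side of the edge, and that side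
  decides the direction.\<close>

lemma hull_edge_cases: "hull_edge V (\<psi> j) (\<psi> (Suc j)) \<or> hull_edge V (\<psi> (Suc j)) (\<psi> j)"
proof -
  let ?p = "\<psi> j" and ?q = "\<psi> (Suc j)"
  have pq: "?p \<noteq> ?q" using Suc_ne(1)[of j] by simp
  have *: "orient ?p ?q r \<noteq> 0" "orient ?p ?q r > 0 \<longleftrightarrow> orient ?p ?q (\<psi> (j + 2)) > 0"
    if r: "r \<in> V - {?p, ?q}" for r
  proof -
    show "orient ?p ?q r \<noteq> 0"
      using convex_position_orient_ne_0[OF convex in_V in_V _ pq] r by auto
    obtain d where "2 \<le> d" "d < n" "r = \<psi> (j + d)" using in_V_cases r by blast
    then show "orient ?p ?q r > 0 \<longleftrightarrow> orient ?p ?q (\<psi> (j + 2)) > 0" using same_side by blast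
  qed
  show ?thesis
  proof (cases "orient ?p ?q (\<psi> (j + 2)) > 0")
    case True
    then show ?thesis using * by (simp add: hull_edge_def)
  next
    case False
    then have "orient ?p ?q r < 0" if "r \<in> V - {?p, ?q}" for r using *[OF that] by linarith
    then have "hull_edge V ?q ?p" by (auto simp: hull_edge_def orient_swap[of ?q ?p])
    then show ?thesis ..
  qed
qed

text \<open>If the direction changed, some vertex would receive hull edges from both its neighbours
  on the cycle, against \<open>hull_edge_source_unique\<close>. So the direction of the first edge
  propagates.\<close>

lemma forward:
  assumes "hull_edge V (\<psi> 0) (\<psi> 1)"
  shows "hull_edge V (\<psi> j) (\<psi> (Suc j))"
proof (induction j)
  case (Suc j)
  then show ?case
    using hull_edge_cases[of "Suc j"] hull_edge_source_unique[of V "\<psi> j" "\<psi> (Suc j)"] Suc_ne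
    by metis
qed (use assms in simp)

lemma backward:
  assumes "\<not> hull_edge V (\<psi> 0) (\<psi> 1)"
  shows "hull_edge V (\<psi> (Suc j)) (\<psi> j)"
proof (induction j)
  case 0
  then show ?case using hull_edge_cases[of 0] assms by simp
next
  case (Suc j)
  then show ?case
    using hull_edge_cases[of "Suc j"] hull_edge_target_unique[of V "\<psi> (Suc j)" "\<psi> j"] Suc_ne
    by metis
qed

end

text \<open>Once start and direction are given, uniqueness of outgoing or incoming hull edges forces
  each next vertex. This is what limits the placements of the cycle to \<open>2 * n\<close>.\<close>

lemma noncrossing_cycle_unique:
  assumes a: "noncrossing_cycle n \<psi> V" and b: "noncrossing_cycle n \<psi>' V"
    and start: "\<psi> 0 = \<psi>' 0" and dir: "hull_edge V (\<psi> 0) (\<psi> 1) \<longleftrightarrow> hull_edge V (\<psi>' 0) (\<psi>' 1)"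
  shows "\<psi> j = \<psi>' j"
proof (induction j)
  case (Suc j)
  interpret A: noncrossing_cycle n \<psi> V by fact
  interpret B: noncrossing_cycle n \<psi>' V by fact
  show ?case
  proof (cases "hull_edge V (\<psi> 0) (\<psi> 1)")
    case True
    then show ?thesis
      using A.forward[of j] B.forward[of j] dir Suc A.Suc_ne B.Suc_ne hull_edge_target_unique
      by metis
  next
    case False
    then show ?thesis
      using A.backward[of j] B.backward[of j] dir Suc A.Suc_ne B.Suc_ne hull_edge_source_unique
      by metis
  qed
qed (rule start)

text \<open>Since \<open>V\<close> has exactly \<open>n\<close> points, the injection
  \<open>\<phi>\<close> is onto \<open>V\<close>; reducing the index modulo \<open>n\<close> makes
  it a periodic sequence.\<close>

lemma embedding_noncrossing_cycle:
  assumes emb: "embedding \<phi> {..<n} (cycle_edges [0..<n] \<union> M) V E"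
    and n: "n \<ge> 3" and V: "card V = n" and cp: "convex_position V"
  shows "noncrossing_cycle n (\<lambda>j. \<phi> (j mod n)) V"
proof
  have n0: "n > 0" using n by simp
  have inj: "inj_on \<phi> {..<n}" and sub: "\<phi> ` {..<n} \<subseteq> V" using emb by (auto simp: embedding_def)
  show "n \<ge> 3" "convex_position V" by fact+
  show "\<phi> (j mod n) = \<phi> (k mod n) \<longleftrightarrow> j mod n = k mod n" for j k
    using inj n0 by (auto simp: inj_on_def)
  have "finite V" using V n0 card_gt_0_iff by blast
  then have "\<phi> ` {..<n} = V" using sub inj V by (intro card_subset_eq) (auto simp: card_image)
  moreover have "range (\<lambda>j. \<phi> (j mod n)) = \<phi> ` {..<n}"
  proof (intro equalityI subsetI)
    fix x assume "x \<in> \<phi> ` {..<n}"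
    then obtain k where "k < n" "x = \<phi> (k mod n)" by auto
    then show "x \<in> range (\<lambda>j. \<phi> (j mod n))" by blast
  qed (use n0 in auto)
  ultimately show "range (\<lambda>j. \<phi> (j mod n)) = V" by simp
  have ce: "{j mod n, Suc j mod n} \<in> cycle_edges [0..<n] \<union> M" for j
  proof -
    have "j mod n < n" using n0 by simp
    moreover have "Suc (j mod n) mod n < n" using n0 by simp
    moreover have "Suc (j mod n) mod n = Suc j mod n" by (simp add: mod_Suc_eq)
    ultimately show ?thesis by (auto simp: cycle_edges_def intro!: exI[of _ "j mod n"])
  qed
  fix j k
  assume ne: "{\<phi> (j mod n), \<phi> (Suc j mod n)} \<noteq> {\<phi> (k mod n), \<phi> (Suc k mod n)}"
  \<comment> \<open>\<open>embedding\<close> speaks of distinct index pairs, so distinctness is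
    pulled back from the images.\<close>
  then have "{j mod n, Suc j mod n} \<noteq> {k mod n, Suc k mod n}"
    by (metis image_empty image_insert)
  then show "open_segment (\<phi> (j mod n)) (\<phi> (Suc j mod n)) \<inter>
      open_segment (\<phi> (k mod n)) (\<phi> (Suc k mod n)) = {}"
    using emb ce unfolding embedding_def by blast
qed

section \<open>Counting\<close>

lemma card_subsets_le_power:
  assumes "finite A"
  shows "card {B. B \<subseteq> A \<and> card B = k} \<le> card A ^ k"
  using n_subsets[OF assms, of k] binomial_le_pow[of k "card A"]
  by (cases "k \<le> card A") (simp_all add: binomial_eq_0)

lemma universal_counting:
  assumes n: "n \<ge> 3" and V: "card V = n" and G: "convex_geometric_graph V E"
    and sub: "\<And>M. M \<in> \<M> \<Longrightarrow> \<Union>M \<subseteq> {..<n}"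
    and two: "\<And>M e. M \<in> \<M> \<Longrightarrow> e \<in> M \<Longrightarrow> card e = 2"
    and card: "\<And>M. M \<in> \<M> \<Longrightarrow> card M = h"
    and emb: "\<And>M. M \<in> \<M> \<Longrightarrow> \<exists>\<phi>. embedding \<phi> {..<n} (cycle_edges [0..<n] \<union> M) V E"
  shows "card \<M> \<le> 2 * n * card E ^ h"
proof -
  have cp: "convex_position V" and sg: "simple_graph V E"
    using G by (auto simp: convex_geometric_graph_def geometric_graph_def)
  have fV: "finite V" using sg by (simp add: simple_graph_def)
  have "E \<subseteq> Pow V" using sg by (auto simp: simple_graph_def)
  then have fE: "finite E" using fV finite_subset by blast
  define \<Phi> where "\<Phi> M = (SOME \<phi>. embedding \<phi> {..<n} (cycle_edges [0..<n] \<union> M) V E)" for M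
  have \<Phi>: "embedding (\<Phi> M) {..<n} (cycle_edges [0..<n] \<union> M) V E" if "M \<in> \<M>" for M
    using emb[OF that] unfolding \<Phi>_def by (rule someI_ex)
  have inj: "inj_on (\<Phi> M) {..<n}" if "M \<in> \<M>" for M
    using \<Phi>[OF that] by (simp add: embedding_def)
  have cyc: "noncrossing_cycle n (\<lambda>j. \<Phi> M (j mod n)) V" if "M \<in> \<M>" for M
    by (rule embedding_noncrossing_cycle[OF \<Phi>[OF that] n V cp])
  \<comment> \<open>The first two components fix the placement of the cycle and take at most
    \<open>2 * n\<close> values; the third is the image of the chords, an \<open>h\<close>-subset of
    \<open>E\<close>.\<close>
  define key where
    "key M = (\<Phi> M 0, hull_edge V (\<Phi> M 0) (\<Phi> M 1), (`) (\<Phi> M) ` M)" for M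
  have inj_im: "inj_on ((`) (\<Phi> M)) (Pow {..<n})" if "M \<in> \<M>" for M
    using inj[OF that] by (rule inj_on_image_Pow)
  have "inj_on key \<M>"
  proof (rule inj_onI)
    fix M N assume M: "M \<in> \<M>" and N: "N \<in> \<M>" and "key M = key N"
    then have k: "\<Phi> M 0 = \<Phi> N 0" "(`) (\<Phi> M) ` M = (`) (\<Phi> N) ` N"
      "hull_edge V (\<Phi> M 0) (\<Phi> M 1) \<longleftrightarrow> hull_edge V (\<Phi> N 0) (\<Phi> N 1)"
      unfolding key_def prod.inject by blast+
    have "1 mod n = 1" using n by simp
    have "\<Phi> M (j mod n) = \<Phi> N (j mod n)" for j
      by (rule noncrossing_cycle_unique[OF cyc[OF M] cyc[OF N]])
        (use k in \<open>simp_all only: \<open>1 mod n = 1\<close> mod_0\<close>)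
    then have eq: "\<Phi> M j = \<Phi> N j" if "j < n" for j using that by (metis mod_less)
    \<comment> \<open>Both maps agree below \<open>n\<close>, so \<open>M\<close> and
      \<open>N\<close> have the same image under a single injective map.\<close>
    have "(`) (\<Phi> N) ` N = (`) (\<Phi> M) ` M" by (rule k(2)[symmetric])
    also have "\<dots> = (`) (\<Phi> N) ` M"
      using sub[OF M] eq by (intro image_cong) (auto intro!: image_cong)
    finally have "(`) (\<Phi> N) ` N = (`) (\<Phi> N) ` M" .
    moreover have "N \<subseteq> Pow {..<n}" "M \<subseteq> Pow {..<n}" using sub[OF M] sub[OF N] by auto
    ultimately show "M = N" using inj_on_image_eq_iff[OF inj_im[OF N]] by metis
  qed
  moreover have "key ` \<M> \<subseteq> V \<times> UNIV \<times> {B. B \<subseteq> E \<and> card B = h}"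
  proof
    fix x assume "x \<in> key ` \<M>"
    then obtain M where M: "M \<in> \<M>" and x: "x = key M" by blast
    have "\<Phi> M 0 \<in> V" using \<Phi>[OF M] n by (auto simp: embedding_def)
    moreover have "card ((`) (\<Phi> M) ` M) = h"
    proof -
      have "inj_on ((`) (\<Phi> M)) M" using inj_im[OF M] sub[OF M] by (auto intro: inj_on_subset)
      then show ?thesis using card[OF M] by (simp add: card_image)
    qed
    moreover have "(`) (\<Phi> M) ` M \<subseteq> E"
    proof clarify
      fix e assume e: "e \<in> M"
      then obtain u v where uv: "e = {u, v}" using two[OF M] by (meson card_2_iff)
      have "{\<Phi> M u, \<Phi> M v} \<in> E" using \<Phi>[OF M] e uv unfolding embedding_def by blast
      then show "\<Phi> M ` e \<in> E" by (simp add: uv)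
    qed
    ultimately show "x \<in> V \<times> UNIV \<times> {B. B \<subseteq> E \<and> card B = h}" by (simp add: x key_def)
  qed
  moreover have fin: "finite (V \<times> (UNIV :: bool set) \<times> {B. B \<subseteq> E \<and> card B = h})"
    using fV fE by auto
  ultimately have "card \<M> \<le> card (V \<times> (UNIV :: bool set) \<times> {B. B \<subseteq> E \<and> card B = h})"
    by (rule card_inj_on_le)
  also have "\<dots> = 2 * n * card {B. B \<subseteq> E \<and> card B = h}"
    by (simp add: card_cartesian_product V)
  also have "\<dots> \<le> 2 * n * card E ^ h" using card_subsets_le_power[OF fE] by simp
  finally show ?thesis .
qed

section \<open>Chord sets with one chord per block\<close>

text \<open>
  The right endpoint is shifted by one so that the two endpoints are never adjacent on the cycle.
\<close>

definition block_chord :: "nat \<Rightarrow> (nat \<Rightarrow> nat) \<times> (nat \<Rightarrow> nat) \<Rightarrow> nat \<Rightarrow> nat set" where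
  "block_chord s fg i = {3 * s * i + fst fg i, 3 * s * i + s + 1 + snd fg i}"

text \<open>Extensional functions are determined by their values below \<open>h\<close>, so a chord
  set determines its parameters.\<close>

definition block_params :: "nat \<Rightarrow> nat \<Rightarrow> ((nat \<Rightarrow> nat) \<times> (nat \<Rightarrow> nat)) set" where
  "block_params h s = ({..<h} \<rightarrow>\<^sub>E {..<s}) \<times> ({..<h} \<rightarrow>\<^sub>E {..<s})"

lemma card_block_params: "card (block_params h s) = s ^ (2 * h)"
  by (simp add: block_params_def card_cartesian_product card_funcsetE power_even_eq power2_eq_square)

lemma block_paramsD:
  assumes "fg \<in> block_params h s" "i < h"
  shows "fst fg i < s" "snd fg i < s"
  using assms by (auto simp: block_params_def mem_Times_iff dest: PiE_mem)

text \<open>Left offsets are below \<open>s\<close> and right offsets at most \<open>2 * s\<close>,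
  hence within the block length \<open>3 * s\<close>. Reading the block off an endpoint is what
  separates the chords of different blocks.\<close>

lemma block_chord_div:
  assumes "fg \<in> block_params h s" "i < h" "x \<in> block_chord s fg i"
  shows "x div (3 * s) = i"
proof -
  have "\<exists>r<3 * s. x = 3 * s * i + r"
    using assms(3) block_paramsD[OF assms(1,2)]
    by (auto simp: block_chord_def intro: exI[of _ "fst fg i"] exI[of _ "s + Suc (snd fg i)"])
  then show ?thesis by auto
qed

text \<open>Within a block, left offsets are below \<open>s\<close> and right offsets above
  \<open>s\<close>, so the unordered pair reveals which endpoint is which.\<close>

lemma block_chord_eqD:
  assumes "fg \<in> block_params h s" "fg' \<in> block_params h s" "i < h" "j < h"
    and eq: "block_chord s fg i = block_chord s fg' j"
  shows "i = j" "fst fg i = fst fg' j" "snd fg i = snd fg' j"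
proof -
  have "3 * s * i + fst fg i \<in> block_chord s fg i" by (simp add: block_chord_def)
  then show "i = j" using block_chord_div assms by metis
  then show "fst fg i = fst fg' j" "snd fg i = snd fg' j"
    using eq block_paramsD[OF assms(1,3)] block_paramsD[OF assms(2,4)]
    by (auto simp: block_chord_def doubleton_eq_iff)
qed

lemma inj_on_block_chord:
  assumes "fg \<in> block_params h s"
  shows "inj_on (block_chord s fg) {..<h}"
  using block_chord_eqD(1)[OF assms assms] by (auto simp: inj_on_def)

lemma inj_on_block_chords:
  "inj_on (\<lambda>fg. block_chord s fg ` {..<h}) (block_params h s)"
proof (rule inj_onI)
  fix fg fg' assume fg: "fg \<in> block_params h s" and fg': "fg' \<in> block_params h s"
    and eq: "block_chord s fg ` {..<h} = block_chord s fg' ` {..<h}"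
  have *: "fst fg i = fst fg' i \<and> snd fg i = snd fg' i" if i: "i < h" for i
  proof -
    have "block_chord s fg i \<in> block_chord s fg' ` {..<h}" using i by (simp flip: eq)
    then obtain j where j: "j < h" "block_chord s fg i = block_chord s fg' j" by auto
    show ?thesis using block_chord_eqD[OF fg fg' i j] by simp
  qed
  have "fst fg = fst fg'" "snd fg = snd fg'"
    using fg fg' * unfolding block_params_def mem_Times_iff by (auto intro: PiE_ext)
  then show "fg = fg'" by (rule prod_eqI)
qed

text \<open>Ordering the endpoints singles out the edge that closes the cycle.\<close>

lemma cycle_edges_uptE:
  assumes "{a, b} \<in> cycle_edges [0..<n]" "a < b"
  obtains "b = Suc a" "b < n" | "a = 0" "Suc b = n"
proof -
  obtain i where i: "i < n" "{a, b} = {i, Suc i mod n}"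
    using assms by (auto simp: cycle_edges_def)
  show ?thesis
  proof (cases "Suc i < n")
    case True
    then show ?thesis using i assms(2) that by (auto simp: doubleton_eq_iff)
  next
    case False
    then have "Suc i = n" using i by simp
    then show ?thesis using i assms(2) that by (auto simp: doubleton_eq_iff)
  qed
qed

lemma block_graph_in_outerplanar_family:
  assumes h: "h \<ge> 1" and s: "s \<ge> 1" "3 * s * h \<le> n" and n: "n \<ge> 4"
    and fg: "fg \<in> block_params h s"
  defines "M \<equiv> block_chord s fg ` {..<h}"
  shows "({..<n}, cycle_edges [0..<n] \<union> M) \<in> outerplanar_family h n"
    and "\<Union>M \<subseteq> {..<n}" and "\<And>e. e \<in> M \<Longrightarrow> card e = 2" and "card M = h"
proof -
  let ?C = "cycle_edges [0..<n]"
  \<comment> \<open>The last \<open>s\<close> is the free end of the block; it will keep the right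
    endpoint away from \<open>n - 1\<close> unless \<open>s = 1\<close>.\<close>
  have bound: "3 * s * i + s + 1 + snd fg i + s \<le> n" if i: "i < h" for i
  proof -
    have "3 * s * Suc i \<le> 3 * s * h" using i by (intro mult_le_mono) auto
    then have "3 * s * i + 3 * s \<le> n" using s by simp
    then show ?thesis using block_paramsD(2)[OF fg i] by linarith
  qed
  have chordE: "\<exists>i<h. e = {a, b} \<and> a = 3 * s * i + fst fg i \<and> b = 3 * s * i + s + 1 + snd fg i"
    if e: "e \<in> M" "e = {a, b}" "a < b" for e a b
  proof -
    obtain i where i: "i < h" "{a, b} = block_chord s fg i" using e by (auto simp: M_def)
    then show ?thesis
      using e block_paramsD[OF fg i(1)]
      by (auto simp: block_chord_def doubleton_eq_iff)
  qed
  show UM: "\<Union>M \<subseteq> {..<n}"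
  proof -
    have "block_chord s fg i \<subseteq> {..<n}" if i: "i < h" for i
      using bound[OF i] block_paramsD[OF fg i] s by (simp add: block_chord_def)
    then show ?thesis by (auto simp: M_def)
  qed
  show M2: "card e = 2" if e: "e \<in> M" for e
  proof -
    obtain i where i: "i < h" "e = block_chord s fg i" using e by (auto simp: M_def)
    then show ?thesis using block_paramsD(1)[OF fg i(1)] by (simp add: block_chord_def)
  qed
  show Mh: "card M = h"
    unfolding M_def by (simp add: card_image[OF inj_on_block_chord[OF fg]])
  have disj: "pairwise disjnt M"
  proof (rule pairwiseI)
    fix e f assume "e \<in> M" "f \<in> M" "e \<noteq> f"
    then obtain i j where ij: "i < h" "j < h" "e = block_chord s fg i" "f = block_chord s fg j"
      by (auto simp: M_def)
    with \<open>e \<noteq> f\<close> have "i \<noteq> j" by auto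
    then show "disjnt e f" using block_chord_div[OF fg] ij by (auto simp: disjnt_iff)
  qed
  have CM: "?C \<inter> M = {}"
  proof (rule ccontr)
    assume "?C \<inter> M \<noteq> {}"
    then obtain e where e: "e \<in> ?C" "e \<in> M" by blast
    then obtain x y where "e = {x, y}" "x \<noteq> y" using M2 by (meson card_2_iff)
    then obtain a b where ab: "e = {a, b}" "a < b"
      by (metis insert_commute linorder_neqE_nat)
    obtain i where i: "i < h" "a = 3 * s * i + fst fg i" "b = 3 * s * i + s + 1 + snd fg i"
      using chordE[OF e(2) ab] by blast
    from e ab have "{a, b} \<in> ?C" by simp
    then show False using \<open>a < b\<close>
    proof (cases rule: cycle_edges_uptE)
      case 1
      then show ?thesis using i block_paramsD[OF fg i(1)] by simp
    next
      case 2
      \<comment> \<open>The chord would be the closing edge from \<open>0\<close> to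
        \<open>n - 1\<close>. The slack in \<open>bound\<close> leaves \<open>s = 1\<close>, where
        the chord is \<open>{0, 2}\<close> and \<open>n = 3\<close>, contrary to
        \<open>n \<ge> 4\<close>.\<close>
      then have "i = 0" using i s by simp
      have "s = 1" using 2 i bound[OF i(1)] s by linarith
      then have "b = 2" using i \<open>i = 0\<close> block_paramsD[OF fg i(1)] by simp
      then show ?thesis using 2 n by simp
    qed
  qed
  have C_sub: "e \<subseteq> {..<n} \<and> card e = 2" if e: "e \<in> ?C" for e
  proof -
    obtain i where i: "i < n" "e = {i, Suc i mod n}" using e by (auto simp: cycle_edges_def)
    have "Suc i mod n \<noteq> i" using i n by (cases "Suc i = n") auto
    then show ?thesis using i by auto
  qed
  have sg: "simple_graph {..<n} (?C \<union> M)"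
    using C_sub UM M2 by (auto simp: simple_graph_def)
  have "outerplanar {..<n} (?C \<union> M)"
  proof (rule outerplanar_noncrossing[OF sg])
    fix a b c d
    assume ab: "{a, b} \<in> ?C \<union> M" and cd: "{c, d} \<in> ?C \<union> M" and o: "a < c" "c < b" "b < d"
    have "{c, d} \<subseteq> {..<n}" using sg cd unfolding simple_graph_def by metis
    then have "d < n" by simp
    have a_b: "a < b" and c_d: "c < d" using o by auto
    \<comment> \<open>Cycle edges interleave with nothing: consecutive labels have no label between
      them, and the closing edge spans all labels.\<close>
    have "{a, b} \<notin> ?C"
    proof
      assume "{a, b} \<in> ?C"
      then show False using a_b by (cases rule: cycle_edges_uptE) (use o \<open>d < n\<close> in auto)
    qed
    moreover have "{c, d} \<notin> ?C"
    proof
      assume "{c, d} \<in> ?C"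
      then show False using c_d by (cases rule: cycle_edges_uptE) (use o in auto)
    qed
    ultimately have M: "{a, b} \<in> M" "{c, d} \<in> M" using ab cd by auto
    obtain i where i: "i < h" "a = 3 * s * i + fst fg i" "b = 3 * s * i + s + 1 + snd fg i"
      using chordE[OF M(1) refl a_b] by blast
    obtain j where j: "j < h" "c = 3 * s * j + fst fg j" "d = 3 * s * j + s + 1 + snd fg j"
      using chordE[OF M(2) refl c_d] by blast
    have "a div (3 * s) = i" "b div (3 * s) = i" "c div (3 * s) = j"
      using block_chord_div[OF fg i(1)] block_chord_div[OF fg j(1)] i j
      by (simp_all add: block_chord_def)
    \<comment> \<open>Block indices are monotone in the label, so \<open>a < c < b\<close> traps
      \<open>c\<close> in the block of \<open>a\<close>, which holds only one chord.\<close>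
    then have "i = j" using o by (metis div_le_mono le_antisym less_imp_le)
    then show False using i j o by simp
  qed
  moreover have "hamiltonian_cycle {..<n} ?C"
    unfolding hamiltonian_cycle_def using n
    by (intro exI[of _ "[0..<n]"]) (auto simp: atLeast0LessThan)
  ultimately show "({..<n}, ?C \<union> M) \<in> outerplanar_family h n"
    unfolding outerplanar_family_def using CM Mh disj by auto
qed

section \<open>The final estimate\<close>

theorem theorem2:
  fixes h :: nat
  assumes "h \<ge> 1"
  shows "\<exists>c::real. c > 0 \<and>
    (\<forall>(n::nat) (V :: (real^2) set) (E :: (real^2) set set).
       n \<ge> 3 * h\<^sup>2 \<longrightarrow> n \<ge> 2 * h + 2 \<longrightarrow>
       convex_geometric_graph V E \<longrightarrow> card V = n \<longrightarrow>
       universal V E (outerplanar_family h n :: (nat set \<times> nat set set) set) \<longrightarrow>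
       real (card E) \<ge> c * real n powr (2 - 1 / real h))"
proof (intro exI[of _ "1 / (72 * (real h)\<^sup>2)"] conjI allI impI)
  \<comment> \<open>Origin of 72: \<open>n \<le> 6 * h * s\<close> contributes
    \<open>36 * h\<^sup>2\<close> after squaring, and the factor 2 of the counting bound is absorbed
    by \<open>2 ^ h\<close>.\<close>
  show "0 < 1 / (72 * (real h)\<^sup>2)" using assms by simp
next
  fix n :: nat and V :: "(real^2) set" and E :: "(real^2) set set"
  assume n3: "n \<ge> 3 * h\<^sup>2" and n2: "n \<ge> 2 * h + 2" and G: "convex_geometric_graph V E"
    and V: "card V = n"
    and univ: "universal V E (outerplanar_family h n :: (nat set \<times> nat set set) set)"
  define s where "s = n div (3 * h)"
  have n4: "n \<ge> 4" using n2 assms by simp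
  \<comment> \<open>The bound \<open>n \<ge> 3 * h\<^sup>2\<close> makes the blocks
    nonempty.\<close>
  have "3 * h \<le> 3 * h\<^sup>2" using assms by (simp add: power2_eq_square)
  then have hn: "3 * h \<le> n" using n3 by simp
  then have s1: "s \<ge> 1" using assms by (simp add: s_def div_greater_zero_iff Suc_le_eq)
  have "3 * h * s \<le> n" unfolding s_def by (rule times_div_less_eq_dividend)
  then have s: "3 * s * h \<le> n" by (simp add: mult.commute mult.left_commute)
  note graph = block_graph_in_outerplanar_family[OF assms s1 s n4]
  let ?\<M> = "(\<lambda>fg. block_chord s fg ` {..<h}) ` block_params h s"
  have "card ?\<M> \<le> 2 * n * card E ^ h"
  proof (rule universal_counting[OF _ V G])
    fix M assume "M \<in> ?\<M>"
    then obtain fg where fg: "fg \<in> block_params h s" and M: "M = block_chord s fg ` {..<h}" by blast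
    show "\<Union>M \<subseteq> {..<n}" "card M = h" "\<And>e. e \<in> M \<Longrightarrow> card e = 2"
      using graph[OF fg] unfolding M by blast+
    show "\<exists>\<phi>. embedding \<phi> {..<n} (cycle_edges [0..<n] \<union> M) V E"
      using univ graph(1)[OF fg] unfolding M universal_def by blast
  next
    show "3 \<le> n" using n4 by simp
  qed
  then have count: "s ^ (2 * h) \<le> 2 * n * card E ^ h"
    by (simp add: card_image[OF inj_on_block_chords] card_block_params)
  \<comment> \<open>Rounding down in \<open>s\<close> costs at most a factor 2, because
    \<open>s \<ge> 1\<close>.\<close>
  have "n < 3 * h * (s + 1)"
    using assms dividend_less_times_div[of "3 * h" n] unfolding s_def by simp
  also have "\<dots> \<le> 3 * h * (2 * s)" using s1 by (intro mult_le_mono) auto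
  finally have "real n \<le> real (3 * h * (2 * s))" by (simp only: of_nat_le_iff less_imp_le)
  then have n_le: "real n \<le> 6 * real h * real s" by simp
  \<comment> \<open>The \<open>h\<close>-th power of \<open>x\<close> is \<open>n\<close> to the
    power \<open>2 * h - 1\<close>; one more factor \<open>n\<close> matches the
    \<open>s ^ (2 * h)\<close> of the count and cancels the \<open>n\<close> on its right
    side.\<close>
  define x where "x = real n powr (2 - 1 / real h)"
  have x: "x ^ h * n = real n ^ (2 * h)"
  proof -
    have "x ^ h = real n powr ((2 - 1 / real h) * real h)"
      using n4 by (simp add: x_def powr_powr flip: powr_realpow)
    also have "(2 - 1 / real h) * real h = 2 * real h - 1" using assms by (simp add: algebra_simps)
    finally have "x ^ h * n = real n powr (2 * real h - 1) * real n powr 1" using n4 by simp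
    also have "\<dots> = real n powr real (2 * h)" by (simp only: flip: powr_add) simp
    also have "\<dots> = real n ^ (2 * h)" by (rule powr_realpow) (use n4 in simp)
    finally show ?thesis .
  qed
  have "x ^ h * n \<le> (6 * real h * real s) ^ (2 * h)"
    unfolding x using n_le by (intro power_mono) auto
  also have "\<dots> = (36 * (real h)\<^sup>2) ^ h * real (s ^ (2 * h))"
    by (simp add: power_mult power_mult_distrib)
  also have "\<dots> \<le> (36 * (real h)\<^sup>2) ^ h * real (2 * n * card E ^ h)"
    using count by (intro mult_left_mono) (simp_all only: of_nat_le_iff, simp)
  finally have "x ^ h \<le> 2 * ((36 * (real h)\<^sup>2) ^ h * real (card E) ^ h)"
    using n4 by (simp add: mult.assoc mult.left_commute mult.commute)
  \<comment> \<open>With \<open>2 ^ h\<close> in place of 2 the right side is an \<open>h\<close>-th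
    power, so that roots can be taken.\<close>
  also have "\<dots> \<le> 2 ^ h * ((36 * (real h)\<^sup>2) ^ h * real (card E) ^ h)"
    using assms power_increasing[of 1 h "2::real"] by (intro mult_right_mono) auto
  also have "\<dots> = (72 * (real h)\<^sup>2 * real (card E)) ^ h"
    by (simp only: power_mult_distrib[symmetric]) (simp add: mult.assoc)
  finally have "x \<le> 72 * (real h)\<^sup>2 * real (card E)"
    using power_mono_iff[of x "72 * (real h)\<^sup>2 * real (card E)" h] assms by (simp add: x_def)
  then show "1 / (72 * (real h)\<^sup>2) * real n powr (2 - 1 / real h) \<le> real (card E)"
    using assms by (simp add: x_def field_simps)
qed

end
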